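(* Consider a DSPI (decentralized shortest path interdiction) game with discrete interdiction with common source-target pairs (all agents have the same source $s$ and the same target $t$), formulated as the generalized Nash equilibrium problem described in the context, and assume that the initial arc lengths $d^0_{uv}$ and the arc extensions $e_{uv}$ are integral. Suppose that the Gauss-Seidel algorithm described in the context is applied to this problem, and the termination criterion $\|\chi_k-\chi_{k-1}\|\le\epsilon$ is used with $\epsilon<1$. Then the algorithm terminates finitely at an equilibrium.
   Context: Data: $G=(V,A)$ is a finite directed network; $\mathcal F=\{1,\dots,F\}$ is the set of agents (interdictors); all agents have source node $s$ and target node $t$ (with at least one directed $s$-$t$ path); agent $f$ has a budget $b^f>0$ and interdiction costs $c^f_{uv}>0$ for $(u,v)\in A$. Initial arc lengths are $d^0_{uv}$ and arc extensions are $e_{uv}\ge 0$. DSPI game with discrete interdiction as a generalized Nash equilibrium problem: agent $f$'s decision is $\chi^f=(x^f,y^f)$ with $x^f=(x^f_{uv})_{(u,v)\in A}$ and $y^f=(y^f_u)_{u\in V}$; $\chi^{-f}$ denotes the decisions of all other agents. Given $\chi^{-f}$, agent $f$ solves the problem $\mathcal P(\chi^{-f})$: maximize $\theta^f(\chi^f,\chi^{-f})=y^f_{t}-y^f_{s}$ over $\chi^f\in\Xi^f(\chi^{-f})$, where $\Xi^f(\chi^{-f})$ is the set of $(x^f,y^f)$ such that $y^f_v-y^f_u\le d^0_{uv}+e_{uv}\max_{g\in\mathcal F}x^g_{uv}$ for all $(u,v)\in A$; $\ \sum_{(u,v)\in A}c^f_{uv}x^f_{uv}\le b^f$; $\ 0\le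 y^f_u\le M$ for all $u\in V$; $\ x^f_{uv}\in\{0,1\}$ for all $(u,v)\in A$. Here $M=\sum_{(u,v)\in A}(d^0_{uv}+e_{uv})$. Since the data are integral, the variables $y^f_u$ are also restricted to be integers (this loses nothing, since at optimality $y^f_u-y^f_{s}$ can be taken to be the length of a shortest $s$-$u$ path). Equilibrium: $\chi=(\chi^1,\dots,\chi^F)$ is an equilibrium if for every $f\in\mathcal F$, $\chi^f\in\Xi^f(\chi^{-f})$ and $\theta^f(\chi^f,\chi^{-f})\ge\theta^f(\xi^f,\chi^{-f})$ for all $\xi^f\in\Xi^f(\chi^{-f})$. Gauss-Seidel algorithm: choose $\chi_0=(\chi_0^1,\dots,\chi_0^F)$ with $\chi^f_0\in\Xi^f(\chi_0^{-f})$ for all $f$; set $k=0$. Step 1: for $f=1,2,\dots,F$ in order, set $\chi_{k,f}^{-f}=(\chi^1_{k+1},\dots,\chi^{f-1}_{k+1},\chi^{f+1}_k,\dots,\chi^F_k)$ and solve $\mathcal P(\chi_{k,f}^{-f})$ to obtain an optimal solution $\chi^*_{k,f}$; if $\theta^f(\chi^*_{k,f},\chi^{-f}_{k,f})>\theta^f(\chi^f_k,\chi^{-f}_{k,f})$ set $\chi^f_{k+1}=\chi^*_{k,f}$, otherwise set $\chi^f_{k+1}=\chi^f_k$. Then set $\chi_{k+1}=(\chi^1_{k+1},\dots,\chi^F_{k+1})$ and increase $k$ by 1. If $\|\chi_k-\chi_{k-1}\|\le\epsilon$ (Euclidean norm; $\epsilon\ge0$ is a fixed tolerance), stop at $\chi_k$;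 otherwise repeat Step 1.
   Formalization: As stated the claim fails: a kept y^f may be infeasible at the end. Proved: finite termination; the final x with suitable y is an equilibrium with the same payoffs; the final profile itself is one if each solve keeps the current x^f whenever it is part of an optimal solution. *)

theory Defs
  imports Complex_Main
begin

record 'v dspi =
  nodes :: "'v set"
  arcs :: "('v \<times> 'v) set"
  source :: 'v
  target :: 'v
  num_agents :: nat
  init_length :: "'v \<times> 'v \<Rightarrow> real"
  extension :: "'v \<times> 'v \<Rightarrow> real"
  cost :: "nat \<Rightarrow> 'v \<times> 'v \<Rightarrow> real"
  budget :: "nat \<Rightarrow> real"

definition agents :: "'v dspi \<Rightarrow> nat set" where
  "agents G = {1..num_agents G}"

definition dspi_game :: "'v dspi \<Rightarrow> bool" where
  "dspi_game G \<longleftrightarrow>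
     finite (nodes G) \<and> arcs G \<subseteq> nodes G \<times> nodes G \<and>
     source G \<in> nodes G \<and> target G \<in> nodes G \<and> (source G, target G) \<in> (arcs G)\<^sup>* \<and>
     1 \<le> num_agents G \<and>
     (\<forall>a\<in>arcs G. 0 \<le> extension G a) \<and>
     (\<forall>f\<in>agents G. 0 < budget G f \<and> (\<forall>a\<in>arcs G. 0 < cost G f a))"

definition bigM :: "'v dspi \<Rightarrow> real" where
  "bigM G = (\<Sum>a\<in>arcs G. init_length G a + extension G a)"

text \<open>A decision is a pair \<open>(x, y)\<close> of an interdiction vector, indexed by arcs, and a potential
  vector, indexed by nodes. Values off the arcs and nodes of the network are irrelevant.\<close>

type_synonym 'v decision = "('v \<times> 'v \<Rightarrow> real) \<times> ('v \<Rightarrow> real)"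
type_synonym 'v profile = "nat \<Rightarrow> 'v decision"

text \<open>The functions below that depend on the decisions of the other agents take a full profile
  \<open>\<chi>\<close>; they overwrite the component of agent \<open>f\<close>, so the feasible set and the optimal
  solutions of agent \<open>f\<close> depend only on \<open>\<chi>\<^sup>-\<^sup>f\<close>.\<close>

definition feasible :: "'v dspi \<Rightarrow> nat \<Rightarrow> 'v profile \<Rightarrow> 'v decision set" where
  "feasible G f \<chi> = {(x, y).
     (\<forall>(u, v)\<in>arcs G. y v - y u \<le> init_length G (u, v)
        + extension G (u, v) * (MAX g\<in>agents G. fst ((\<chi>(f := (x, y))) g) (u, v))) \<and>
     (\<Sum>a\<in>arcs G. cost G f a * x a) \<le> budget G f \<and>
     (\<forall>u\<in>nodes G. 0 \<le> y u \<and> y u \<le> bigM G \<and> y u \<in> \<int>) \<and>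
     (\<forall>a\<in>arcs G. x a \<in> {0, 1})}"

definition payoff :: "'v dspi \<Rightarrow> nat \<Rightarrow> 'v profile \<Rightarrow> real" where
  "payoff G f \<chi> = snd (\<chi> f) (target G) - snd (\<chi> f) (source G)"

definition optimal :: "'v dspi \<Rightarrow> nat \<Rightarrow> 'v profile \<Rightarrow> 'v decision set" where
  "optimal G f \<chi> = {\<xi> \<in> feasible G f \<chi>.
     \<forall>\<zeta>\<in>feasible G f \<chi>. payoff G f (\<chi>(f := \<zeta>)) \<le> payoff G f (\<chi>(f := \<xi>))}"

definition equilibrium :: "'v dspi \<Rightarrow> 'v profile \<Rightarrow> bool" where
  "equilibrium G \<chi> \<longleftrightarrow> (\<forall>f\<in>agents G. \<chi> f \<in> feasible G f \<chi> \<and>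
     (\<forall>\<xi>\<in>feasible G f \<chi>. payoff G f (\<chi>(f := \<xi>)) \<le> payoff G f \<chi>))"

text \<open>\<open>S k f \<chi>\<close> is the optimal solution that the solver returns in iteration \<open>k\<close> for the problem
  of agent \<open>f\<close> when the current decisions are \<open>\<chi>\<close>. Which optimal solution is returned is left
  open: it may vary with the iteration and with the incumbent \<open>\<chi> f\<close>.\<close>

type_synonym 'v solver = "nat \<Rightarrow> nat \<Rightarrow> 'v profile \<Rightarrow> 'v decision"

definition solves :: "'v dspi \<Rightarrow> 'v solver \<Rightarrow> bool" where
  "solves G S \<longleftrightarrow>
     (\<forall>k. \<forall>f\<in>agents G. \<forall>\<chi>. optimal G f \<chi> \<noteq> {} \<longrightarrow> S k f \<chi> \<in> optimal G f \<chi>)"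

text \<open>A tie-breaking rule: the solver does not move to another interdiction vector while the
  current one is still part of an optimal solution. Without it, the final profile can fail to be an
  equilibrium, for feasibility only: an agent whose payoff is already optimal keeps its potentials
  although another agent has since moved, with a tie in the path length, to other arcs.\<close>

definition keeps_incumbent :: "'v dspi \<Rightarrow> 'v solver \<Rightarrow> bool" where
  "keeps_incumbent G S \<longleftrightarrow>
     (\<forall>k. \<forall>f\<in>agents G. \<forall>\<chi>. (\<exists>y. (fst (\<chi> f), y) \<in> optimal G f \<chi>) \<longrightarrow>
        (\<forall>a\<in>arcs G. fst (S k f \<chi>) a = fst (\<chi> f) a))"

text \<open>\<open>gs_pass G T \<chi> f\<close> is the profile after agents \<open>1, \<dots>, f\<close> have had their turn, where \<open>T\<close> is
  the solver of the current iteration. Note that the incumbent is compared by its payoff only;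
  it need not be feasible any more, since earlier agents may have lowered the lengths of arcs.\<close>

primrec gs_pass ::
  "'v dspi \<Rightarrow> (nat \<Rightarrow> 'v profile \<Rightarrow> 'v decision) \<Rightarrow> 'v profile \<Rightarrow> nat \<Rightarrow> 'v profile" where
  "gs_pass G T \<chi> 0 = \<chi>"
| "gs_pass G T \<chi> (Suc f) =
     (let \<psi> = gs_pass G T \<chi> f; \<psi>' = \<psi>(Suc f := T (Suc f) \<psi>)
      in if payoff G (Suc f) \<psi>' > payoff G (Suc f) \<psi> then \<psi>' else \<psi>)"

primrec gauss_seidel :: "'v dspi \<Rightarrow> 'v solver \<Rightarrow> 'v profile \<Rightarrow> nat \<Rightarrow> 'v profile" where
  "gauss_seidel G S \<chi>0 0 = \<chi>0"
| "gauss_seidel G S \<chi>0 (Suc k) = gs_pass G (S k) (gauss_seidel G S \<chi>0 k) (num_agents G)"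

definition profile_dist :: "'v dspi \<Rightarrow> 'v profile \<Rightarrow> 'v profile \<Rightarrow> real" where
  "profile_dist G \<chi> \<psi> = sqrt (\<Sum>f\<in>agents G.
     (\<Sum>a\<in>arcs G. (fst (\<chi> f) a - fst (\<psi> f) a)\<^sup>2) + (\<Sum>u\<in>nodes G. (snd (\<chi> f) u - snd (\<psi> f) u)\<^sup>2))"

definition stops_at :: "'v dspi \<Rightarrow> real \<Rightarrow> (nat \<Rightarrow> 'v profile) \<Rightarrow> nat \<Rightarrow> bool" where
  "stops_at G \<epsilon> X k \<longleftrightarrow> 0 < k \<and> profile_dist G (X k) (X (k - 1)) \<le> \<epsilon> \<and>
     (\<forall>j. 0 < j \<and> j < k \<longrightarrow> \<not> profile_dist G (X j) (X (j - 1)) \<le> \<epsilon>)"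

end

(* All agents have the same s-t pair, so for fixed interdiction vectors they share one optimum: the
   largest spread y t - y s over all potentials y, called the value below. An agent's turn never
   lowers the value, and no payoff exceeds it. A move raises the payoff of the mover, and hence its
   own potential at s or t, by at least 1. So moves cannot go on forever, and a distance below 1
   means that no agent has moved. At such a profile every payoff equals the value and no agent can
   raise it, so a potential attaining the value makes the interdiction vectors an equilibrium.
   If the solver keeps incumbents, then the arc lengths change only when the value strictly
   increases; an agent whose payoff equals the value therefore still has a feasible potential. *)
theory Submission
  imports Defs
begin

section \<open>The constraints shared by all agents and their common value\<close>

definition arc_length :: "'v dspi \<Rightarrow> 'v profile \<Rightarrow> 'v \<times> 'v \<Rightarrow> real" where
  "arc_length G \<chi> a = init_length G a + extension G a * (MAX g\<in>agents G. fst (\<chi> g) a)"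

text \<open>The part of feasibility that names no agent. It depends on the profile only through the
  interdiction vectors, so all agents optimize over the same potentials.\<close>

definition potential :: "'v dspi \<Rightarrow> 'v profile \<Rightarrow> ('v \<Rightarrow> real) \<Rightarrow> bool" where
  "potential G \<chi> y \<longleftrightarrow> (\<forall>(u, v)\<in>arcs G. y v - y u \<le> arc_length G \<chi> (u, v)) \<and>
     (\<forall>u\<in>nodes G. 0 \<le> y u \<and> y u \<le> bigM G \<and> y u \<in> \<int>)"

definition interdiction :: "'v dspi \<Rightarrow> nat \<Rightarrow> ('v \<times> 'v \<Rightarrow> real) \<Rightarrow> bool" where
  "interdiction G f x \<longleftrightarrow>
     (\<Sum>a\<in>arcs G. cost G f a * x a) \<le> budget G f \<and> (\<forall>a\<in>arcs G. x a \<in> {0, 1})"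

definition spread :: "'v dspi \<Rightarrow> ('v \<Rightarrow> real) \<Rightarrow> real" where
  "spread G y = y (target G) - y (source G)"

text \<open>Meaningful only if some potential exists, which \<open>consistent\<close> ensures below;
  the spreads then form a finite nonempty set.\<close>

definition game_value :: "'v dspi \<Rightarrow> 'v profile \<Rightarrow> real" where
  "game_value G \<chi> = Max (spread G ` Collect (potential G \<chi>))"

text \<open>Restricted to arcs because decisions are total functions whose values elsewhere carry no
  meaning; a solver that keeps an incumbent may still change those.\<close>

definition same_interdiction :: "'v dspi \<Rightarrow> 'v profile \<Rightarrow> 'v profile \<Rightarrow> bool" where
  "same_interdiction G \<chi> \<psi> \<longleftrightarrow> (\<forall>g\<in>agents G. \<forall>a\<in>arcs G. fst (\<chi> g) a = fst (\<psi> g) a)"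

lemma potential_cong: "same_interdiction G \<chi> \<psi> \<Longrightarrow> potential G \<chi> = potential G \<psi>"
proof -
  assume *: "same_interdiction G \<chi> \<psi>"
  have "(\<lambda>g. fst (\<chi> g) a) ` agents G = (\<lambda>g. fst (\<psi> g) a) ` agents G" if "a \<in> arcs G" for a
    using * that by (intro image_cong) (auto simp: same_interdiction_def)
  then have "arc_length G \<chi> a = arc_length G \<psi> a" if "a \<in> arcs G" for a
    using that by (simp add: arc_length_def)
  then show ?thesis by (auto simp: potential_def fun_eq_iff)
qed

lemma same_interdiction_upd:
  "fst \<xi> = fst (\<chi> f) \<Longrightarrow> same_interdiction G (\<chi>(f := \<xi>)) \<chi>"
  by (simp add: same_interdiction_def)

lemma feasible_iff:
  "\<xi> \<in> feasible G f \<chi> \<longleftrightarrow> interdiction G f (fst \<xi>) \<and> potential G (\<chi>(f := \<xi>)) (snd \<xi>)"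
  by (cases \<xi>) (auto simp: feasible_def interdiction_def potential_def arc_length_def)

lemma payoff_eq_spread: "payoff G f \<chi> = spread G (snd (\<chi> f))"
  by (simp add: payoff_def spread_def)

section \<open>A single turn, and the invariants and order that track it\<close>

definition gs_turn :: "'v dspi \<Rightarrow> nat \<Rightarrow> 'v decision \<Rightarrow> 'v profile \<Rightarrow> 'v profile" where
  "gs_turn G f \<xi> \<chi> = (if payoff G f (\<chi>(f := \<xi>)) > payoff G f \<chi> then \<chi>(f := \<xi>) else \<chi>)"

text \<open>Isolates the answer of the solver as a parameter, so that facts about a turn need only
  its optimality.\<close>

lemma gs_pass_Suc:
  "gs_pass G T \<chi> (Suc f) = gs_turn G (Suc f) (T (Suc f) (gs_pass G T \<chi> f)) (gs_pass G T \<chi> f)"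
  by (simp add: gs_turn_def Let_def)

text \<open>What survives of feasibility during the iteration. The potentials of an agent that has
  not moved may violate arc constraints once others have moved, but its payoff stays below the value
  and its terminal potentials stay integral.\<close>

definition consistent :: "'v dspi \<Rightarrow> 'v profile \<Rightarrow> bool" where
  "consistent G \<chi> \<longleftrightarrow> (\<exists>y. potential G \<chi> y) \<and>
     (\<forall>f\<in>agents G. interdiction G f (fst (\<chi> f)) \<and> payoff G f \<chi> \<le> game_value G \<chi> \<and>
        snd (\<chi> f) (source G) \<in> \<int> \<and> snd (\<chi> f) (target G) \<in> \<int>)"

text \<open>Agents below the value are exempt: their potentials may be outdated, but they have an
  improving move at their next turn.\<close>

definition current :: "'v dspi \<Rightarrow> 'v profile \<Rightarrow> bool" where
  "current G \<chi> \<longleftrightarrow>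
     (\<forall>f\<in>agents G. payoff G f \<chi> = game_value G \<chi> \<longrightarrow> potential G \<chi> (snd (\<chi> f)))"

text \<open>A partial order on profiles. Its first alternative is equality of whole functions, which
  fits \<open>gs_turn\<close>: without a strict gain it returns the very same profile.\<close>

definition progress :: "'v dspi \<Rightarrow> 'v profile \<Rightarrow> 'v profile \<Rightarrow> bool" where
  "progress G \<chi> \<psi> \<longleftrightarrow> (\<forall>f\<in>agents G. payoff G f \<chi> \<le> payoff G f \<psi>) \<and>
     (\<psi> = \<chi> \<or> (\<exists>f\<in>agents G. payoff G f \<chi> + 1 \<le> payoff G f \<psi>))"

lemma progress_refl: "progress G \<chi> \<chi>"
  by (simp add: progress_def)

lemma progress_trans: "progress G \<chi> \<psi> \<Longrightarrow> progress G \<psi> \<phi> \<Longrightarrow> progress G \<chi> \<phi>"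
  unfolding progress_def by (elim conjE disjE) (force intro: order_trans)+

lemma progress_antisym: "progress G \<chi> \<psi> \<Longrightarrow> progress G \<psi> \<chi> \<Longrightarrow> \<chi> = \<psi>"
  unfolding progress_def by (elim conjE disjE) force+

lemma Ints_less_imp_add_one_le:
  fixes a b :: real
  assumes "a \<in> \<int>" "b \<in> \<int>" "a < b"
  shows "a + 1 \<le> b"
  using assms by (auto elim!: Ints_cases)

text \<open>Supplies the monovariant for termination: a proper step raises one summand by at least 1
  and lowers none.\<close>

lemma sum_progress:
  assumes "progress G \<chi> \<psi>"
  shows "\<psi> = \<chi> \<or> (\<Sum>f\<in>agents G. payoff G f \<chi>) + 1 \<le> (\<Sum>f\<in>agents G. payoff G f \<psi>)"
proof (cases "\<psi> = \<chi>")
  case False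
  then obtain f where f: "f \<in> agents G" "payoff G f \<chi> + 1 \<le> payoff G f \<psi>"
    using assms by (auto simp: progress_def)
  have fin: "finite (agents G)" by (simp add: agents_def)
  have "(\<Sum>g\<in>agents G - {f}. payoff G g \<chi>) \<le> (\<Sum>g\<in>agents G - {f}. payoff G g \<psi>)"
    using assms by (intro sum_mono) (auto simp: progress_def)
  with f show ?thesis by (simp add: sum.remove[OF fin f(1)])
qed simp

lemma profile_dist_same: "profile_dist G \<chi> \<chi> = 0"
  by (simp add: profile_dist_def)

section \<open>Existence of maxima and the value after an optimal answer\<close>

context
  fixes G :: "'v dspi"
  assumes game: "dspi_game G"
begin

lemma terminals_in_nodes: "source G \<in> nodes G" "target G \<in> nodes G"
  using game by (auto simp: dspi_game_def)

lemma finite_nodes: "finite (nodes G)"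
  using game by (simp add: dspi_game_def)

lemma spread_potential:
  assumes "potential G \<chi> y"
  shows "spread G y \<in> \<int>" "\<bar>spread G y\<bar> \<le> bigM G"
proof -
  have *: "0 \<le> y u \<and> y u \<le> bigM G \<and> y u \<in> \<int>" if "u \<in> nodes G" for u
    using assms that by (simp add: potential_def)
  note * = *[OF terminals_in_nodes(1)] *[OF terminals_in_nodes(2)]
  show "spread G y \<in> \<int>" using * by (simp add: spread_def)
  show "\<bar>spread G y\<bar> \<le> bigM G" using * by (simp add: spread_def abs_le_iff)
qed

lemma finite_bounded_Ints: "finite {z::real. z \<in> \<int> \<and> \<bar>z\<bar> \<le> bigM G}"
proof (rule finite_subset)
  show "{z::real. z \<in> \<int> \<and> \<bar>z\<bar> \<le> bigM G} \<subseteq> of_int ` {-\<lceil>bigM G\<rceil>..\<lceil>bigM G\<rceil>}"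
  proof
    fix z :: real assume "z \<in> {z. z \<in> \<int> \<and> \<bar>z\<bar> \<le> bigM G}"
    then obtain i where i: "z = of_int i" "\<bar>real_of_int i\<bar> \<le> bigM G" by (auto elim: Ints_cases)
    then have "i \<in> {-\<lceil>bigM G\<rceil>..\<lceil>bigM G\<rceil>}" by simp linarith
    with i(1) show "z \<in> of_int ` {-\<lceil>bigM G\<rceil>..\<lceil>bigM G\<rceil>}" by blast
  qed
qed simp

text \<open>There may be infinitely many potentials, since values off the nodes are free, but their
  spreads are integers between \<open>- bigM G\<close> and \<open>bigM G\<close>.\<close>

lemma finite_spreads: "finite (spread G ` Collect (potential G \<chi>))"
  by (rule finite_subset[OF _ finite_bounded_Ints]) (auto dest: spread_potential)

lemma spread_le_game_value: "potential G \<chi> y \<Longrightarrow> spread G y \<le> game_value G \<chi>"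
  unfolding game_value_def by (rule Max_ge[OF finite_spreads]) simp

lemma game_value_attained:
  assumes "potential G \<chi> y"
  obtains y' where "potential G \<chi> y'" "spread G y' = game_value G \<chi>"
proof -
  have "game_value G \<chi> \<in> spread G ` Collect (potential G \<chi>)"
    unfolding game_value_def using assms by (intro Max_in finite_spreads) auto
  then show ?thesis using that by auto
qed

lemma optimal_exists:
  assumes "feasible G f \<chi> \<noteq> {}"
  shows "optimal G f \<chi> \<noteq> {}"
proof -
  let ?P = "(\<lambda>\<xi>. spread G (snd \<xi>)) ` feasible G f \<chi>"
  have fin: "finite ?P"
    by (rule finite_subset[OF _ finite_bounded_Ints])
       (auto simp: feasible_iff dest: spread_potential)
  from fin have "Max ?P \<in> ?P" using assms by (intro Max_in) auto
  then obtain \<xi> where "\<xi> \<in> feasible G f \<chi>" "spread G (snd \<xi>) = Max ?P" by auto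
  then have "\<xi> \<in> optimal G f \<chi>"
    using Max_ge[OF fin] by (simp add: optimal_def payoff_eq_spread)
  then show ?thesis by blast
qed

text \<open>Any potential for the updated profile can be combined with the interdiction vector of
  \<xi> into a feasible decision of agent \<open>f\<close>, so none can beat \<xi>.\<close>

lemma game_value_optimal:
  assumes "\<xi> \<in> optimal G f \<chi>"
  shows "game_value G (\<chi>(f := \<xi>)) = spread G (snd \<xi>)"
proof -
  have \<xi>: "interdiction G f (fst \<xi>)" "potential G (\<chi>(f := \<xi>)) (snd \<xi>)"
    using assms by (auto simp: optimal_def feasible_iff)
  obtain y where y: "potential G (\<chi>(f := \<xi>)) y" "spread G y = game_value G (\<chi>(f := \<xi>))"
    using game_value_attained[OF \<xi>(2)] .
  have "same_interdiction G (\<chi>(f := (fst \<xi>, y))) (\<chi>(f := \<xi>))"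
    by (simp add: same_interdiction_def)
  with y(1) \<xi>(1) have "(fst \<xi>, y) \<in> feasible G f \<chi>"
    by (simp add: feasible_iff potential_cong)
  then have "spread G y \<le> spread G (snd \<xi>)"
    using assms by (auto simp: optimal_def payoff_eq_spread)
  with y(2) spread_le_game_value[OF \<xi>(2)] show ?thesis by simp
qed

section \<open>The effect of one turn on the invariants\<close>

lemma consistent_feasible:
  assumes "consistent G \<chi>" "f \<in> agents G" "potential G \<chi> y"
  shows "(fst (\<chi> f), y) \<in> feasible G f \<chi>"
  \<comment> \<open>Replacing only the potentials of agent \<open>f\<close> leaves every arc length
    unchanged.\<close>
  using assms potential_cong[OF same_interdiction_upd[of "(fst (\<chi> f), y)" \<chi> f G]]
  by (simp add: consistent_def feasible_iff)

lemma consistent_optimal_exists: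
  assumes "consistent G \<chi>" "f \<in> agents G"
  shows "optimal G f \<chi> \<noteq> {}"
  using assms consistent_feasible optimal_exists by (metis consistent_def empty_iff)

text \<open>The agent can keep its interdiction vector and adopt a potential that attains the
  value.\<close>

lemma game_value_le_optimal:
  assumes "consistent G \<chi>" "f \<in> agents G" "\<xi> \<in> optimal G f \<chi>"
  shows "game_value G \<chi> \<le> spread G (snd \<xi>)"
proof -
  obtain y where "potential G \<chi> y" "spread G y = game_value G \<chi>"
    using assms(1) game_value_attained unfolding consistent_def by metis
  then show ?thesis
    using consistent_feasible[OF assms(1,2)] assms(3) by (force simp: optimal_def payoff_eq_spread)
qed

text \<open>The value does not drop, so it still bounds the unchanged payoffs of the other agents;
  the payoff of the mover equals the new value.\<close>

lemma consistent_gs_turn: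
  assumes "consistent G \<chi>" "f \<in> agents G" "\<xi> \<in> optimal G f \<chi>"
  shows "consistent G (gs_turn G f \<xi> \<chi>)"
proof -
  have \<xi>: "interdiction G f (fst \<xi>)" "potential G (\<chi>(f := \<xi>)) (snd \<xi>)"
    using assms(3) by (auto simp: optimal_def feasible_iff)
  have "game_value G \<chi> \<le> game_value G (\<chi>(f := \<xi>))"
    using game_value_le_optimal[OF assms] game_value_optimal[OF assms(3)] by simp
  moreover have "snd \<xi> (source G) \<in> \<int>" "snd \<xi> (target G) \<in> \<int>"
    using \<xi>(2) terminals_in_nodes by (auto simp: potential_def)
  ultimately have "consistent G (\<chi>(f := \<xi>))"
    using assms(1) \<xi> game_value_optimal[OF assms(3)]
    unfolding consistent_def by (fastforce simp: payoff_eq_spread)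
  with assms(1) show ?thesis by (simp add: gs_turn_def)
qed

text \<open>Both payoffs are integers, so a strict gain is a gain of at least 1.\<close>

lemma progress_gs_turn:
  assumes "consistent G \<chi>" "f \<in> agents G" "\<xi> \<in> optimal G f \<chi>"
  shows "progress G \<chi> (gs_turn G f \<xi> \<chi>)"
proof (cases "payoff G f \<chi> < payoff G f (\<chi>(f := \<xi>))")
  case True
  have "potential G (\<chi>(f := \<xi>)) (snd \<xi>)"
    using assms(3) by (auto simp: optimal_def feasible_iff)
  then have "payoff G f (\<chi>(f := \<xi>)) \<in> \<int>"
    by (simp add: payoff_eq_spread spread_potential)
  moreover have "payoff G f \<chi> \<in> \<int>"
    using assms(1,2) by (auto simp: consistent_def payoff_def)
  ultimately have "payoff G f \<chi> + 1 \<le> payoff G f (\<chi>(f := \<xi>))"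
    using True by (intro Ints_less_imp_add_one_le)
  with True assms(2) show ?thesis
    by (auto simp: progress_def gs_turn_def payoff_def)
qed (simp add: gs_turn_def progress_refl)

text \<open>If another agent's payoff equals the new value, then the value did not rise. The mover's
  old interdiction vector was then still optimal, so the tie-breaking rule forces unchanged arc
  lengths.\<close>

lemma current_gs_turn:
  assumes "consistent G \<chi>" "f \<in> agents G" "\<xi> \<in> optimal G f \<chi>" "current G \<chi>"
    and keep: "(\<exists>y. (fst (\<chi> f), y) \<in> optimal G f \<chi>) \<Longrightarrow> \<forall>a\<in>arcs G. fst \<xi> a = fst (\<chi> f) a"
  shows "current G (gs_turn G f \<xi> \<chi>)"
proof -
  let ?\<psi> = "\<chi>(f := \<xi>)"
  have pot: "potential G ?\<psi> (snd \<xi>)"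
    using assms(3) by (auto simp: optimal_def feasible_iff)
  have "potential G ?\<psi> (snd (\<chi> g))"
    if g: "g \<in> agents G" "g \<noteq> f" "payoff G g \<chi> = game_value G ?\<psi>" for g
  proof -
    have "payoff G g \<chi> \<le> game_value G \<chi>"
      using assms(1) g(1) by (simp add: consistent_def)
    \<comment> \<open>The chain payoff \<le> old value \<le> spread of \<xi> = new value collapses,
      as its two ends agree.\<close>
    with g(3) game_value_le_optimal[OF assms(1-3)] game_value_optimal[OF assms(3)]
    have eq: "payoff G g \<chi> = game_value G \<chi>" "game_value G \<chi> = spread G (snd \<xi>)" by simp_all
    have pg: "potential G \<chi> (snd (\<chi> g))"
      using assms(4) g(1) eq(1) by (simp add: current_def)
    \<comment> \<open>The common terminals let agent \<open>f\<close> borrow the potential of agent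
      \<open>g\<close> and reach the same payoff.\<close>
    have "(fst (\<chi> f), snd (\<chi> g)) \<in> optimal G f \<chi>"
      using consistent_feasible[OF assms(1,2) pg] assms(3) eq
      by (simp add: optimal_def payoff_eq_spread)
    then have "same_interdiction G ?\<psi> \<chi>"
      using keep by (auto simp: same_interdiction_def)
    with pg show ?thesis by (simp add: potential_cong)
  qed
  with pot have "current G ?\<psi>"
    by (auto simp: current_def payoff_eq_spread)
  with assms(4) show ?thesis by (simp add: gs_turn_def)
qed

section \<open>Full passes over the agents\<close>

lemma gs_pass_invariant:
  assumes "consistent G \<chi>" "f \<le> num_agents G"
    and opt: "\<And>g \<psi>. g \<in> agents G \<Longrightarrow> optimal G g \<psi> \<noteq> {} \<Longrightarrow> T g \<psi> \<in> optimal G g \<psi>"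
  shows "consistent G (gs_pass G T \<chi> f) \<and> progress G \<chi> (gs_pass G T \<chi> f)"
  using assms(2)
proof (induction f)
  case 0
  then show ?case using assms(1) by (simp add: progress_refl)
next
  case (Suc f)
  let ?\<psi> = "gs_pass G T \<chi> f"
  have f: "Suc f \<in> agents G" using Suc.prems by (simp add: agents_def)
  have IH: "consistent G ?\<psi>" "progress G \<chi> ?\<psi>" using Suc by auto
  have "T (Suc f) ?\<psi> \<in> optimal G (Suc f) ?\<psi>"
    using opt f consistent_optimal_exists IH(1) by blast
  then show ?case
    using IH f consistent_gs_turn progress_gs_turn progress_trans
    unfolding gs_pass_Suc by blast
qed

lemma current_gs_pass:
  assumes "consistent G \<chi>" "f \<le> num_agents G" "current G \<chi>"
    and opt: "\<And>g \<psi>. g \<in> agents G \<Longrightarrow> optimal G g \<psi> \<noteq> {} \<Longrightarrow> T g \<psi> \<in> optimal G g \<psi>"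
    and keep: "\<And>g \<psi>. g \<in> agents G \<Longrightarrow> \<exists>y. (fst (\<psi> g), y) \<in> optimal G g \<psi> \<Longrightarrow>
      \<forall>a\<in>arcs G. fst (T g \<psi>) a = fst (\<psi> g) a"
  shows "current G (gs_pass G T \<chi> f)"
  using assms(2)
proof (induction f)
  case 0
  then show ?case using assms(3) by simp
next
  case (Suc f)
  let ?\<psi> = "gs_pass G T \<chi> f"
  have f: "Suc f \<in> agents G" using Suc.prems by (simp add: agents_def)
  have c: "consistent G ?\<psi>" using gs_pass_invariant[OF assms(1) _ opt] Suc.prems by simp
  have "T (Suc f) ?\<psi> \<in> optimal G (Suc f) ?\<psi>"
    using opt f consistent_optimal_exists c by blast
  then show ?case
    unfolding gs_pass_Suc using c f Suc keep by (intro current_gs_turn) auto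
qed

text \<open>Equality of the first and last profile must exclude moves that undo each other. Every
  intermediate profile lies between \<chi> and \<chi> in the order \<open>progress\<close>, so
  antisymmetry makes it \<chi>, and each agent was tested against \<chi> itself.\<close>

lemma gs_pass_fixed:
  assumes "consistent G \<chi>" "gs_pass G T \<chi> (num_agents G) = \<chi>" "f \<in> agents G"
    and opt: "\<And>g \<psi>. g \<in> agents G \<Longrightarrow> optimal G g \<psi> \<noteq> {} \<Longrightarrow> T g \<psi> \<in> optimal G g \<psi>"
  shows "payoff G f (\<chi>(f := T f \<chi>)) \<le> payoff G f \<chi>"
proof -
  have remaining: "progress G (gs_pass G T \<chi> j) (gs_pass G T \<chi> (num_agents G))"
    if "j \<le> num_agents G" for j
    using that
  proof (induction j rule: inc_induct)
    case (step j)
    let ?\<psi> = "gs_pass G T \<chi> j"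
    have j: "Suc j \<in> agents G" using step.hyps by (simp add: agents_def)
    have c: "consistent G ?\<psi>"
      using gs_pass_invariant[OF assms(1) _ opt] step.hyps by simp
    have "T (Suc j) ?\<psi> \<in> optimal G (Suc j) ?\<psi>"
      using opt j consistent_optimal_exists c by blast
    then have "progress G ?\<psi> (gs_pass G T \<chi> (Suc j))"
      unfolding gs_pass_Suc by (rule progress_gs_turn[OF c j])
    then show ?case using step.IH by (rule progress_trans)
  qed (rule progress_refl)
  have fixed: "gs_pass G T \<chi> j = \<chi>" if "j \<le> num_agents G" for j
    using remaining[OF that] gs_pass_invariant[OF assms(1) that opt] assms(2)
    by (metis progress_antisym)
  \<comment> \<open>Agents are numbered from 1, so \<open>f\<close> has its turn after
    \<open>j\<close> earlier ones.\<close>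
  obtain j where j: "f = Suc j" "Suc j \<le> num_agents G"
    using assms(3) by (cases f) (auto simp: agents_def)
  have "gs_turn G f (T f \<chi>) \<chi> = \<chi>"
    using gs_pass_Suc[of G T \<chi> j] fixed[of j] fixed[of "Suc j"] j by simp
  then show ?thesis by (metis gs_turn_def linorder_not_less order_less_irrefl)
qed

section \<open>The stopping criterion and finite termination\<close>

lemma potential_diff_le_profile_dist:
  assumes "f \<in> agents G" "u \<in> nodes G"
  shows "\<bar>snd (\<chi> f) u - snd (\<psi> f) u\<bar> \<le> profile_dist G \<chi> \<psi>"
proof -
  let ?D = "\<lambda>f. (\<Sum>a\<in>arcs G. (fst (\<chi> f) a - fst (\<psi> f) a)\<^sup>2) +
    (\<Sum>u\<in>nodes G. (snd (\<chi> f) u - snd (\<psi> f) u)\<^sup>2)"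
  have nonneg: "0 \<le> ?D g" for g by (intro add_nonneg_nonneg sum_nonneg) auto
  have "(snd (\<chi> f) u - snd (\<psi> f) u)\<^sup>2 \<le> (\<Sum>u\<in>nodes G. (snd (\<chi> f) u - snd (\<psi> f) u)\<^sup>2)"
    using assms(2) finite_nodes by (intro member_le_sum) auto
  also have "\<dots> \<le> ?D f" by (simp add: sum_nonneg)
  also have "\<dots> \<le> (\<Sum>f\<in>agents G. ?D f)"
    using assms(1) nonneg by (intro member_le_sum) (auto simp: agents_def)
  finally show ?thesis
    unfolding profile_dist_def by (intro real_le_rsqrt) simp
qed

text \<open>Terminal potentials are integers, so a change of less than 1 is no change. Hence no
  payoff differs, which excludes the gain of 1 that a move would bring.\<close>

lemma progress_profile_dist:
  assumes "consistent G \<chi>" "consistent G \<psi>" "progress G \<chi> \<psi>" "profile_dist G \<psi> \<chi> < 1"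
  shows "\<psi> = \<chi>"
proof (rule ccontr)
  assume "\<psi> \<noteq> \<chi>"
  then obtain f where f: "f \<in> agents G" "payoff G f \<chi> + 1 \<le> payoff G f \<psi>"
    using assms(3) by (auto simp: progress_def)
  have "snd (\<psi> f) u = snd (\<chi> f) u" if "u \<in> {source G, target G}" for u
  proof -
    have "\<bar>snd (\<psi> f) u - snd (\<chi> f) u\<bar> < 1"
      using potential_diff_le_profile_dist[OF f(1), of u \<psi> \<chi>] that terminals_in_nodes assms(4)
      by fastforce
    moreover have "snd (\<psi> f) u - snd (\<chi> f) u \<in> \<int>"
      using assms(1,2) f(1) that by (auto simp: consistent_def)
    ultimately show ?thesis using Ints_nonzero_abs_less1 by fastforce
  qed
  with f(2) show False by (simp add: payoff_def)
qed

text \<open>Otherwise the sum of all payoffs would grow by at least 1 per iteration, yet each payoff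
  is at most the value and hence at most \<open>bigM G\<close>.\<close>

lemma gs_terminates:
  assumes "\<And>k. consistent G (X k)" "\<And>k. progress G (X k) (X (Suc k))"
  shows "\<exists>k. X (Suc k) = X k"
proof (rule ccontr)
  assume no: "\<nexists>k. X (Suc k) = X k"
  let ?\<Phi> = "\<lambda>k. \<Sum>f\<in>agents G. payoff G f (X k)"
  have grow: "?\<Phi> 0 + real k \<le> ?\<Phi> k" for k
  proof (induction k)
    case (Suc k)
    then show ?case using sum_progress[OF assms(2)[of k]] no by auto
  qed simp
  have "payoff G f (X k) \<le> bigM G" if "f \<in> agents G" for f k
  proof -
    obtain y where "potential G (X k) y" "spread G y = game_value G (X k)"
      using assms(1)[of k] game_value_attained unfolding consistent_def by metis
    then have "game_value G (X k) \<le> bigM G" using spread_potential(2) by fastforce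
    then show ?thesis using assms(1)[of k] that by (force simp: consistent_def)
  qed
  then have upper: "?\<Phi> k \<le> (\<Sum>f\<in>agents G. bigM G)" for k
    by (intro sum_mono)
  obtain k where "(\<Sum>f\<in>agents G. bigM G) - ?\<Phi> 0 < real k"
    using reals_Archimedean2 by blast
  then show False using grow[of k] upper[of k] by linarith
qed

section \<open>From stationary profiles to equilibria\<close>

lemma stationary_payoff:
  assumes "consistent G \<chi>" "f \<in> agents G" "\<xi> \<in> optimal G f \<chi>"
    and "payoff G f (\<chi>(f := \<xi>)) \<le> payoff G f \<chi>"
  shows "payoff G f \<chi> = game_value G \<chi>"
    and "\<And>\<zeta>. \<zeta> \<in> feasible G f \<chi> \<Longrightarrow> spread G (snd \<zeta>) \<le> payoff G f \<chi>"
proof -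
  show "payoff G f \<chi> = game_value G \<chi>"
    \<comment> \<open>The chain payoff \<le> value \<le> spread of \<xi> \<le> payoff closes
      up.\<close>
    using assms game_value_le_optimal[OF assms(1-3)]
    by (force simp: consistent_def payoff_eq_spread)
  show "spread G (snd \<zeta>) \<le> payoff G f \<chi>" if "\<zeta> \<in> feasible G f \<chi>" for \<zeta>
    using that assms(3,4) by (force simp: optimal_def payoff_eq_spread)
qed

text \<open>Optimality is known for \<chi>, while \<psi> may carry other potentials. The feasible
  sets agree because they see the other agents only through their interdiction vectors. This serves
  both \<chi> itself and \<chi> with repaired potentials.\<close>

lemma equilibriumI:
  assumes "consistent G \<chi>"
    and "\<And>f. f \<in> agents G \<Longrightarrow> fst (\<psi> f) = fst (\<chi> f)"
    and "\<And>f. f \<in> agents G \<Longrightarrow> potential G \<chi> (snd (\<psi> f))"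
    and "\<And>f. f \<in> agents G \<Longrightarrow> spread G (snd (\<psi> f)) = payoff G f \<chi>"
    and "\<And>f \<zeta>. f \<in> agents G \<Longrightarrow> \<zeta> \<in> feasible G f \<chi> \<Longrightarrow> spread G (snd \<zeta>) \<le> payoff G f \<chi>"
  shows "equilibrium G \<psi>"
  unfolding equilibrium_def
proof (intro ballI conjI)
  fix f assume f: "f \<in> agents G"
  have "potential G (\<psi>(f := \<zeta>)) = potential G (\<chi>(f := \<zeta>))" for \<zeta>
    using assms(2) by (intro potential_cong) (simp add: same_interdiction_def)
  then have eq: "feasible G f \<psi> = feasible G f \<chi>"
    by (auto simp: feasible_iff)
  show "\<psi> f \<in> feasible G f \<psi>"
    using consistent_feasible[OF assms(1) f assms(3)[OF f]] assms(2)[OF f] eq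
    by (metis prod.collapse)
  show "payoff G f (\<psi>(f := \<zeta>)) \<le> payoff G f \<psi>" if "\<zeta> \<in> feasible G f \<psi>" for \<zeta>
    using assms(4,5) f that eq by (simp add: payoff_eq_spread)
qed

end

text \<open>The last conjunct holds for every solver: outdated potentials are replaced, while
  interdiction vectors and payoffs are kept. With the tie-breaking rule the stopping profile itself
  is an equilibrium.\<close>

theorem proposition5:
  fixes G :: "'v dspi" and S :: "'v solver" and \<chi>0 :: "'v profile" and \<epsilon> :: real
  assumes "dspi_game G"
    and "\<forall>a\<in>arcs G. init_length G a \<in> \<int> \<and> extension G a \<in> \<int>"
    and "\<forall>f\<in>agents G. \<chi>0 f \<in> feasible G f \<chi>0"
    and "solves G S"
    and "0 \<le> \<epsilon>" and "\<epsilon> < 1"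
  shows "\<exists>k. stops_at G \<epsilon> (gauss_seidel G S \<chi>0) k \<and>
    (keeps_incumbent G S \<longrightarrow> equilibrium G (gauss_seidel G S \<chi>0 k)) \<and>
    (\<exists>y. equilibrium G (\<lambda>f. (fst (gauss_seidel G S \<chi>0 k f), y f)) \<and>
       (\<forall>f\<in>agents G. y f (target G) - y f (source G) = payoff G f (gauss_seidel G S \<chi>0 k)))"
proof -
  note game = assms(1)
  let ?X = "gauss_seidel G S \<chi>0"
  have opt: "S k f \<chi> \<in> optimal G f \<chi>" if "f \<in> agents G" "optimal G f \<chi> \<noteq> {}" for k f \<chi>
    using assms(4) that by (simp add: solves_def)
  have start: "interdiction G f (fst (\<chi>0 f)) \<and> potential G \<chi>0 (snd (\<chi>0 f))"
    if "f \<in> agents G" for f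
    using assms(3) that by (simp add: feasible_iff)
  \<comment> \<open>There is at least one agent, and its initial potentials witness that the shared
    constraints are solvable.\<close>
  have "1 \<in> agents G" using game by (simp add: dspi_game_def agents_def)
  with start have "\<exists>y. potential G \<chi>0 y" by blast
  moreover have "snd (\<chi>0 f) (source G) \<in> \<int>" "snd (\<chi>0 f) (target G) \<in> \<int>"
    if "f \<in> agents G" for f
    using start[OF that] terminals_in_nodes[OF game] by (auto simp: potential_def)
  ultimately have start_consistent: "consistent G \<chi>0"
    using start spread_le_game_value[OF game] by (simp add: consistent_def payoff_eq_spread)
  have con: "consistent G (?X k)" for k
  proof (induction k)
    case (Suc k)
    then show ?case using gs_pass_invariant[OF game _ _ opt] by simp
  qed (simp add: start_consistent)
  have prog: "progress G (?X k) (?X (Suc k))" for k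
    using gs_pass_invariant[OF game con _ opt] by simp
  \<comment> \<open>Indexed by the earlier of the two iterates: the least such \<open>k\<close>
    means that the algorithm stops at \<open>Suc k\<close>.\<close>
  let ?stop = "\<lambda>k. profile_dist G (?X (Suc k)) (?X k) \<le> \<epsilon>"
  obtain k0 where "?X (Suc k0) = ?X k0"
    using gs_terminates[OF game, of ?X, OF con prog] by blast
  then have "?stop k0" using profile_dist_same assms(5) by metis
  then obtain k where k: "?stop k" "\<And>j. j < k \<Longrightarrow> \<not> ?stop j"
    using exists_least_iff[of ?stop] by blast
  have stops: "stops_at G \<epsilon> ?X (Suc k)"
    unfolding stops_at_def
  proof (intro conjI allI impI)
    show "\<not> profile_dist G (?X j) (?X (j - 1)) \<le> \<epsilon>" if "0 < j \<and> j < Suc k" for j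
      using k(2)[of "j - 1"] that by (cases j) auto
  qed (use k(1) in simp_all)
  have fixed: "?X (Suc k) = ?X k"
    using progress_profile_dist[OF game con con prog] k(1) assms(6) by fastforce
  define \<chi> where "\<chi> = ?X (Suc k)"
  \<comment> \<open>The last pass started from \<open>?X k\<close>, which \<open>fixed\<close>
    identifies with \<chi>; so the answers of \<open>S k\<close> are tested at \<chi>.\<close>
  have pass: "gs_pass G (S k) \<chi> (num_agents G) = \<chi>" and cons: "consistent G \<chi>"
    using fixed con[of "Suc k"] by (simp_all add: \<chi>_def)
  have sol: "S k f \<chi> \<in> optimal G f \<chi>" if "f \<in> agents G" for f
    using opt consistent_optimal_exists[OF game cons] that by blast
  have stat: "payoff G f (\<chi>(f := S k f \<chi>)) \<le> payoff G f \<chi>" if "f \<in> agents G" for f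
    using gs_pass_fixed[OF game cons pass that opt] .
  note val = stationary_payoff(1)[OF game cons _ sol stat]
  note best = stationary_payoff(2)[OF game cons _ sol stat]
  obtain y where y: "potential G \<chi> y" "spread G y = game_value G \<chi>"
    using cons game_value_attained[OF game] unfolding consistent_def by metis
  \<comment> \<open>One potential attaining the value serves all agents, since every payoff equals
    the value.\<close>
  have "equilibrium G (\<lambda>f. (fst (\<chi> f), y))"
    by (rule equilibriumI[OF game cons]) (use y val best in auto)
  moreover have "y (target G) - y (source G) = payoff G f \<chi>" if "f \<in> agents G" for f
    using y(2) val[OF that that that] by (simp add: spread_def)
  moreover have "equilibrium G \<chi>" if keep: "keeps_incumbent G S"
  proof -
    have cur: "current G (?X j)" for j
    proof (induction j)
      case 0
      show ?case using start by (simp add: current_def)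
    next
      case (Suc j)
      have "current G (gs_pass G (S j) (?X j) (num_agents G))"
        using keep
        by (intro current_gs_pass[OF game con _ Suc opt]) (auto simp: keeps_incumbent_def)
      then show ?case by simp
    qed
    then have "potential G \<chi> (snd (\<chi> f))" if "f \<in> agents G" for f
      using cur[of "Suc k"] val that unfolding current_def \<chi>_def by blast
    then show ?thesis
      by (intro equilibriumI[OF game cons])
         (use best in \<open>auto simp: payoff_eq_spread\<close>)
  qed
  ultimately show ?thesis using stops unfolding \<chi>_def by (intro exI[of _ "Suc k"]) fastforce
qed

end
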